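(* Assume $\diamondsuit$. Then there is an $\mathrm{HFC}_w$ space $X\subseteq 2^{\omega_1}$ such that $X$, with the subspace topology inherited from the Tychonoff product $2^{\omega_1}$, is not strongly $D$.
   Context: $\diamondsuit$ is Jensen's diamond principle on $\omega_1$: there is a sequence $\langle A_\alpha:\alpha<\omega_1\rangle$ with $A_\alpha\subseteq\alpha$ such that for every $A\subseteq\omega_1$ the set $\{\alpha<\omega_1: A\cap\alpha=A_\alpha\}$ is stationary in $\omega_1$. For a set $I$, $2^I$ carries the Tychonoff product topology ($2=\{0,1\}$ discrete). For a finite partial function $s$ from $I$ to $2$, $[s]=\{x\in 2^I: x\supset s\}$ is the corresponding basic open set. Let $\lambda$ be an uncountable cardinal. For $n<\omega$, $F\in[\lambda]^n$ (an $n$-element subset of $\lambda$) and $b\in 2^n$, $F*b$ denotes the function from $F$ to $2$ taking value $b(i)$ on the $i$-th element of $F$ (in increasing order). A set $X\subseteq 2^\lambda$ is called an $\mathrm{HFC}_w$ space if for every $n<\omega$ and every uncountable, pairwise disjoint family $\mathcal F\subseteq[\lambda]^n$ there is a countable $\mathcal F_0\subseteq\mathcal F$ such that for every $b\in 2^n$, $\left|X\setminus\bigcup\{[F*b]:F\in\mathcal F_0\}\right|\le\omega$. A neighbourhood assignment on a topological space $X$ is a family $\{U_x:x\in X\}$ of open subsets of $X$ with $x\in U_x$ for every $x\in X$. A space $X$ is strongly $D$ if for every neighbourhood assignment $\{U_x:x\in X\}$ there is a set $D\subseteq X$ such that $\{U_x:x\in D\}$ covers $X$ and $D$ is locally finite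 in the topology on $X$ generated by $\{U_x:x\in X\}$, i.e., for each $z\in X$ there is a finite $F\subseteq X$ such that $z\in\bigcap\{U_x:x\in F\}$ and $D\cap\bigcap\{U_x:x\in F\}$ is finite. *)

theory Defs
  imports "HOL-Analysis.Analysis"
begin

section \<open>The ordinal $\omega_1$ as a well-ordered type\<close>

text \<open>
  \<open>cardSuc natLeq\<close> is the library's successor cardinal of $\aleph_0$, a well-order on a set of
  sets of naturals. An element \<open>\<alpha>\<close> of the type is an ordinal $\alpha < \omega_1$; the von Neumann
  ordinal $\alpha$, viewed as a set, is \<open>{..<\<alpha>}\<close>.
\<close>

lemma Card_order_omega1: "Card_order (cardSuc natLeq)"
  by (simp add: cardSuc_Card_order natLeq_Card_order)

lemma Well_order_omega1: "Well_order (cardSuc natLeq)"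
  using Card_order_omega1 card_order_on_well_order_on by blast

typedef omega1 = "Field (cardSuc natLeq)"
proof -
  have "infinite (Field (cardSuc natLeq))"
    using cardSuc_finite[OF natLeq_Card_order] by (simp add: Field_natLeq)
  then show ?thesis by (metis ex_in_conv finite.emptyI)
qed

instantiation omega1 :: linorder
begin

definition less_eq_omega1 :: "omega1 \<Rightarrow> omega1 \<Rightarrow> bool" where
  "(a::omega1) \<le> b \<longleftrightarrow> (Rep_omega1 a, Rep_omega1 b) \<in> cardSuc natLeq"

definition less_omega1 :: "omega1 \<Rightarrow> omega1 \<Rightarrow> bool" where
  "(a::omega1) < b \<longleftrightarrow> a \<le> b \<and> a \<noteq> b"

instance
proof
  have lin: "Linear_order (cardSuc natLeq)"
    using Well_order_omega1 by (simp add: well_order_on_def)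
  then have refl: "refl_on (Field (cardSuc natLeq)) (cardSuc natLeq)"
    and tr: "trans (cardSuc natLeq)" and as: "antisym (cardSuc natLeq)"
    and tot: "total_on (Field (cardSuc natLeq)) (cardSuc natLeq)"
    by (auto simp: order_on_defs)
  fix x y z :: omega1
  show "x \<le> x" using refl Rep_omega1 by (auto simp: less_eq_omega1_def refl_on_def)
  show "x \<le> y \<Longrightarrow> y \<le> z \<Longrightarrow> x \<le> z" using tr by (auto simp: less_eq_omega1_def elim: transE)
  show as': "x \<le> y \<Longrightarrow> y \<le> x \<Longrightarrow> x = y"
    using antisymD[OF as] by (metis Rep_omega1_inject less_eq_omega1_def)
  show "x < y \<longleftrightarrow> x \<le> y \<and> \<not> y \<le> x"
    using antisymD[OF as] \<open>x \<le> x\<close>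
    by (metis Rep_omega1_inject less_eq_omega1_def less_omega1_def)
  show "x \<le> y \<or> y \<le> x"
    using tot refl Rep_omega1[of x] Rep_omega1[of y]
    by (cases "x = y") (auto simp: less_eq_omega1_def total_on_def refl_on_def Rep_omega1_inject)
qed

end

lemma less_omega1_iff:
  "a < b \<longleftrightarrow> (Rep_omega1 a, Rep_omega1 b) \<in> cardSuc natLeq - Id"
  by (simp add: less_omega1_def less_eq_omega1_def Rep_omega1_inject)

instance omega1 :: wellorder
proof
  fix P :: "omega1 \<Rightarrow> bool" and a
  assume step: "\<And>x. (\<And>y. y < x \<Longrightarrow> P y) \<Longrightarrow> P x"
  have "wf (cardSuc natLeq - Id)"
    using Well_order_omega1 by (simp add: well_order_on_def)
  then have "wf (inv_image (cardSuc natLeq - Id) Rep_omega1)" by (rule wf_inv_image)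
  then show "P a"
    by (induction a rule: wf_induct_rule) (auto intro: step simp: less_omega1_iff in_inv_image)
qed

lemma countable_iff_ordLeq_natLeq: "countable A \<longleftrightarrow> (card_of A, natLeq) \<in> ordLeq"
proof -
  have "countable A \<longleftrightarrow> (card_of A, card_of (UNIV :: nat set)) \<in> ordLeq"
    unfolding countable_def card_of_ordLeq[symmetric] by auto
  then show ?thesis
    using card_of_nat ordLeq_ordIso_trans ordIso_symmetric by blast
qed

lemma uncountable_omega1: "uncountable (UNIV :: omega1 set)"
proof
  assume c: "countable (UNIV :: omega1 set)"
  have "Field (cardSuc natLeq) = range Rep_omega1"
    by (metis type_definition.Rep_range type_definition_omega1)
  with c have "(card_of (Field (cardSuc natLeq)), natLeq) \<in> ordLeq"
    by (simp flip: countable_iff_ordLeq_natLeq)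
  then have "(cardSuc natLeq, natLeq) \<in> ordLeq"
    using card_of_Field_ordIso[OF Card_order_omega1] ordIso_ordLeq_trans ordIso_symmetric by blast
  then show False
    using cardSuc_greater[OF natLeq_Card_order] not_ordLess_ordLeq by blast
qed

lemma countable_lessThan_omega1: "countable {..<a :: omega1}"
proof -
  let ?S = "underS (cardSuc natLeq) (Rep_omega1 a)"
  have "(card_of ?S, cardSuc natLeq) \<in> ordLess"
    using Card_order_omega1 Rep_omega1 by (rule card_of_underS)
  then have "countable ?S"
    using cardSuc_ordLeq_ordLess[OF natLeq_Card_order card_of_Card_order[of ?S]]
    by (simp add: countable_iff_ordLeq_natLeq)
  moreover have "Rep_omega1 ` {..<a} \<subseteq> ?S"
    by (auto simp: less_omega1_iff underS_def)
  moreover have "inj_on Rep_omega1 {..<a}"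
    by (simp add: inj_on_def Rep_omega1_inject)
  ultimately show ?thesis
    by (meson countable_image_inj_on countable_subset)
qed


section \<open>Jensen's diamond principle\<close>

definition unbounded_omega1 :: "omega1 set \<Rightarrow> bool" where
  "unbounded_omega1 C \<longleftrightarrow> (\<forall>\<alpha>. \<exists>\<gamma>\<in>C. \<alpha> < \<gamma>)"

text \<open>The condition \<open>{..<\<alpha>} \<noteq> {}\<close> excludes \<open>\<alpha> = 0\<close>; the other premise then forces \<open>\<alpha>\<close> to be a
  limit ordinal.\<close>

definition closed_omega1 :: "omega1 set \<Rightarrow> bool" where
  "closed_omega1 C \<longleftrightarrow>
     (\<forall>\<alpha>. {..<\<alpha>} \<noteq> {} \<and> (\<forall>\<beta><\<alpha>. \<exists>\<gamma>\<in>C. \<beta> < \<gamma> \<and> \<gamma> < \<alpha>) \<longrightarrow> \<alpha> \<in> C)"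

definition stationary_omega1 :: "omega1 set \<Rightarrow> bool" where
  "stationary_omega1 S \<longleftrightarrow>
     (\<forall>C. closed_omega1 C \<and> unbounded_omega1 C \<longrightarrow> S \<inter> C \<noteq> {})"

definition diamond :: bool where
  "diamond \<longleftrightarrow>
     (\<exists>A :: omega1 \<Rightarrow> omega1 set.
        (\<forall>\<alpha>. A \<alpha> \<subseteq> {..<\<alpha>}) \<and>
        (\<forall>B. stationary_omega1 {\<alpha>. B \<inter> {..<\<alpha>} = A \<alpha>}))"


section \<open>The space $2^I$ and \<open>HFC\<^sub>w\<close> spaces\<close>

definition two_power :: "('i \<Rightarrow> bool) topology" where
  "two_power = product_topology (\<lambda>_. discrete_topology UNIV) UNIV"

definition basic_open :: "('i \<rightharpoonup> bool) \<Rightarrow> ('i \<Rightarrow> bool) set" where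
  "basic_open s = {x. s \<subseteq>\<^sub>m Some \<circ> x}"

text \<open>An element of $2^n$ is a Boolean list of length $n$.\<close>

definition star_fun :: "'i::linorder set \<Rightarrow> bool list \<Rightarrow> ('i \<rightharpoonup> bool)" where
  "star_fun F b = map_of (zip (sorted_list_of_set F) b)"

text \<open>The cardinal $\lambda$ is given as a well-ordered index type. Finiteness of the members of
  \<open>\<F>\<close> is required explicitly because \<open>card\<close> is \<open>0\<close> on infinite sets.\<close>

definition HFC_w :: "('i::wellorder \<Rightarrow> bool) set \<Rightarrow> bool" where
  "HFC_w X \<longleftrightarrow>
     (\<forall>(n::nat) \<F>.
        uncountable \<F> \<and> pairwise disjnt \<F> \<and> (\<forall>F\<in>\<F>. finite F \<and> card F = n) \<longrightarrow>
        (\<exists>\<F>\<^sub>0. \<F>\<^sub>0 \<subseteq> \<F> \<and> countable \<F>\<^sub>0 \<and>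
           (\<forall>b. length b = n \<longrightarrow>
              countable (X - (\<Union>F\<in>\<F>\<^sub>0. basic_open (star_fun F b))))))"


section \<open>Strongly \<open>D\<close> spaces\<close>

definition neighbourhood_assignment :: "'a topology \<Rightarrow> ('a \<Rightarrow> 'a set) \<Rightarrow> bool" where
  "neighbourhood_assignment T U \<longleftrightarrow> (\<forall>x\<in>topspace T. openin T (U x) \<and> x \<in> U x)"

text \<open>The intersection over \<open>N = {}\<close> is the whole space, by the explicit \<open>topspace T\<close>.\<close>

definition strongly_D :: "'a topology \<Rightarrow> bool" where
  "strongly_D T \<longleftrightarrow>
     (\<forall>U. neighbourhood_assignment T U \<longrightarrow>
        (\<exists>D \<subseteq> topspace T.
           topspace T \<subseteq> (\<Union>x\<in>D. U x) \<and>
           (\<forall>z\<in>topspace T. \<exists>N \<subseteq> topspace T. finite N \<and>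
              z \<in> topspace T \<inter> (\<Inter>x\<in>N. U x) \<and>
              finite (D \<inter> (topspace T \<inter> (\<Inter>x\<in>N. U x))))))"

end

(*
  The space consists of points x_d (d < omega_1) with x_d(e) = 1 for e >= d, so that only the set
  H_d = {e < d. x_d(e) = 1} has to be chosen; the neighbourhood of x_d is {x. x(d) = 1}.

  At stage d diamond guesses an uncountable disjoint family of n-sets, and if possible we fix a
  sequence F_i of members of the guess that converges to d and, for each j < n, has an associated
  set L_j that realizes all earlier sequences but finitely many, each of whose elements lies in H_a,
  a the j-th element of F_i, for almost all i ("realizes": every 0-1 pattern occurs on some F_i).
  From then on every H_d realizes every fixed sequence up to d, with finitely many exceptions.
  Since a given family is guessed infinitely often while each point has only finitely many
  exceptions, the space is HFC_w.

  Diamond also guesses, as a subset A of d, the index set of a candidate for D. If every fixed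
  sequence is eventually disjoint from A, then H_d can be taken disjoint from A, so that x_d is not
  covered. Otherwise some sequence, fixed at c, has its j-th elements in A infinitely often; then we
  let H_d agree below c with L_j, the exceptions being those of L_j and c, and x_d is an accumulation
  point of the candidate in the coarse topology.
*)

theory Submission
  imports Defs "HOL-Algebra.Free_Abelian_Groups"
begin

section \<open>Countable ordinals\<close>

lemma countable_atMost_omega1: "countable {..a :: omega1}"
proof -
  have "{..a} = insert a {..<a}" by auto
  then show ?thesis using countable_lessThan_omega1 by simp
qed

lemma countable_strict_bound_omega1:
  fixes A :: "omega1 set"
  assumes "countable A"
  obtains b where "\<And>a. a \<in> A \<Longrightarrow> a < b"
proof -
  have "countable (\<Union>a\<in>A. {..a})"
    using assms countable_atMost_omega1 by (intro countable_UN)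
  then obtain b where "b \<notin> (\<Union>a\<in>A. {..a})"
    using uncountable_omega1 by (metis countable_subset subsetI)
  then show thesis
    using that[of b] by (metis UN_I atMost_iff linorder_not_le)
qed

text \<open>The points above \<open>\<alpha>\<close> that are closed under \<open>\<psi>\<close>
  form a club: a limit of such points is one, and iterating a bound for \<open>\<psi>\<close>
  countably often leads to one above any given ordinal.\<close>

lemma stationary_omega1_closure_point:
  fixes \<psi> :: "omega1 \<Rightarrow> omega1"
  assumes "stationary_omega1 S"
  obtains \<eta> where "\<eta> \<in> S" "\<alpha> < \<eta>" "\<And>\<zeta>. \<zeta> < \<eta> \<Longrightarrow> \<psi> \<zeta> < \<eta>"
proof -
  define C where "C = {\<eta>. \<alpha> < \<eta> \<and> (\<forall>\<zeta><\<eta>. \<psi> \<zeta> < \<eta>)}"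
  have "closed_omega1 C"
    unfolding closed_omega1_def
  proof (intro allI impI)
    fix \<eta> assume *: "{..<\<eta>} \<noteq> {} \<and> (\<forall>\<beta><\<eta>. \<exists>\<gamma>\<in>C. \<beta> < \<gamma> \<and> \<gamma> < \<eta>)"
    then obtain \<beta> where "\<beta> < \<eta>" by auto
    with * have "\<alpha> < \<eta>" by (force simp: C_def)
    moreover have "\<psi> \<zeta> < \<eta>" if "\<zeta> < \<eta>" for \<zeta>
      using * that by (force simp: C_def)
    ultimately show "\<eta> \<in> C" by (simp add: C_def)
  qed
  moreover have "unbounded_omega1 C"
    unfolding unbounded_omega1_def
  proof
    fix \<beta>
    \<comment> \<open>Bounding \<open>\<psi>\<close> on all of \<open>{..\<xi>}\<close>, not just at
      \<open>\<xi>\<close>, makes monotonicity of \<open>\<psi>\<close> unnecessary; including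
      \<open>\<xi>\<close> itself makes the iterates increase.\<close>
    have "\<exists>b. \<forall>a\<in>insert \<xi> (\<psi> ` {..\<xi>}). a < b" for \<xi>
    proof -
      have "countable (insert \<xi> (\<psi> ` {..\<xi>}))"
        using countable_atMost_omega1 by simp
      then show ?thesis
        by (meson countable_strict_bound_omega1)
    qed
    then obtain \<theta> where \<theta>: "\<And>\<xi> a. a \<in> insert \<xi> (\<psi> ` {..\<xi>}) \<Longrightarrow> a < \<theta> \<xi>"
      by metis
    define s where "s k = (\<theta> ^^ k) (max \<alpha> \<beta>)" for k
    define \<eta> where "\<eta> = (LEAST b. \<forall>k. s k < b)"
    obtain b0 where "\<And>a. a \<in> range s \<Longrightarrow> a < b0"
      by (rule countable_strict_bound_omega1[of "range s"]) auto
    then have "\<forall>k. s k < b0" by blast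
    then have s: "s k < \<eta>" for k
      unfolding \<eta>_def by (rule LeastI2) blast
    have "\<psi> \<zeta> < \<eta>" if "\<zeta> < \<eta>" for \<zeta>
    proof -
      have "\<not> (\<forall>k. s k < \<zeta>)"
        using that unfolding \<eta>_def by (rule not_less_Least)
      then obtain k where "\<zeta> \<le> s k" by (auto simp: not_less)
      then have "\<psi> \<zeta> < \<theta> (s k)" by (intro \<theta>) auto
      also have "\<theta> (s k) = s (Suc k)" by (simp add: s_def)
      also have "\<dots> < \<eta>" by (rule s)
      finally show ?thesis .
    qed
    moreover have "\<alpha> < \<eta>" "\<beta> < \<eta>" using s[of 0] by (auto simp: s_def)
    ultimately show "\<exists>\<gamma>\<in>C. \<beta> < \<gamma>" by (auto simp: C_def)
  qed
  ultimately obtain \<eta> where "\<eta> \<in> S \<inter> C"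
    using assms by (auto simp: stationary_omega1_def)
  then show thesis using that by (auto simp: C_def)
qed

text \<open>By disjointness each element of \<open>A\<close> lies in at most one member, so only
  countably many members meet \<open>A\<close>.\<close>

lemma uncountable_disjoint_family_avoids:
  assumes "uncountable \<F>" "pairwise disjnt \<F>" "countable A"
  obtains F where "F \<in> \<F>" "F \<inter> A = {}"
proof -
  have "countable {F \<in> \<F>. F \<inter> A \<noteq> {}}"
  proof (rule countable_subset)
    show "{F \<in> \<F>. F \<inter> A \<noteq> {}} \<subseteq> (\<lambda>a. THE F. F \<in> \<F> \<and> a \<in> F) ` A"
    proof
      fix F assume F: "F \<in> {F \<in> \<F>. F \<inter> A \<noteq> {}}"
      then obtain a where a: "a \<in> F" "a \<in> A" by auto
      have "(THE F. F \<in> \<F> \<and> a \<in> F) = F"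
        using F a assms(2) by (intro the_equality) (auto simp: pairwise_def disjnt_iff)
      then show "F \<in> (\<lambda>a. THE F. F \<in> \<F> \<and> a \<in> F) ` A" using a(2) by (intro image_eqI[of _ _ a]) simp_all
    qed
    show "countable ((\<lambda>a. THE F. F \<in> \<F> \<and> a \<in> F) ` A)" using assms(3) by simp
  qed
  with assms(1) have "\<not> \<F> \<subseteq> {F \<in> \<F>. F \<inter> A \<noteq> {}}" by (meson countable_subset)
  then show thesis using that by blast
qed

lemma ex_inj_list_omega1: "\<exists>c :: omega1 list \<Rightarrow> omega1. inj c"
proof -
  have "infinite (UNIV :: omega1 set)" using uncountable_omega1 by (auto intro: countable_finite)
  from lists_infinite_bij_betw_types[OF this] show ?thesis
    by (auto simp: bij_betw_def)
qed


section \<open>The recursive construction\<close>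

text \<open>Arity \<open>0\<close> means that no sequence is fixed at this stage; \<open>realizes\<close> is then trivially true.
  \<open>bits (g \<delta>)\<close> is $H_\delta$, of which only the part below \<open>\<delta>\<close> matters.\<close>

datatype stage = Stage (arity: nat) (seq: "nat \<Rightarrow> omega1 list")
  (bits: "omega1 set") (exempt: "omega1 set")

definition realizes :: "stage \<Rightarrow> omega1 set \<Rightarrow> bool" where
  "realizes s H \<longleftrightarrow>
     (\<forall>b. length b = arity s \<longrightarrow> (\<exists>i. \<forall>k<arity s. (seq s i ! k \<in> H) = b ! k))"

text \<open>The limits \<open>L\<close> are one-sided: nothing is asked of ordinals outside
  \<open>L\<close>. This suffices because the neighbourhoods to be used only demand that coordinates
  be 1. Only stages below \<open>\<delta>\<close> are consulted, so the notion is available before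
  stage \<open>\<delta>\<close> is chosen.\<close>

definition converging :: "(omega1 \<Rightarrow> stage) \<Rightarrow> omega1 \<Rightarrow> nat \<Rightarrow> (nat \<Rightarrow> omega1 list) \<Rightarrow> bool" where
  "converging g \<delta> n f \<longleftrightarrow>
     (\<forall>i. length (f i) = n \<and> distinct (f i) \<and> set (f i) \<subseteq> {..<\<delta>}) \<and>
     (\<forall>\<zeta><\<delta>. \<forall>\<^sub>F i in sequentially. \<forall>\<alpha>\<in>set (f i). \<zeta> < \<alpha>) \<and>
     (\<forall>j<n. \<exists>L W. L \<subseteq> {..<\<delta>} \<and> finite W \<and> (\<forall>\<gamma>\<in>{..<\<delta>} - W. realizes (g \<gamma>) L) \<and>
        (\<forall>\<xi>\<in>L. \<forall>\<^sub>F i in sequentially. \<xi> \<in> bits (g (f i ! j))))"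

text \<open>The injection \<open>c\<close> lets the diamond sequence \<open>A\<close> guess families of finite sets, given by their
  increasing enumerations. The same guess \<open>A \<delta>\<close> is used in both readings: as a family of lists and,
  in the last conjunct, as a set of indices of points.\<close>

definition correct ::
    "(omega1 list \<Rightarrow> omega1) \<Rightarrow> (omega1 \<Rightarrow> omega1 set) \<Rightarrow> (omega1 \<Rightarrow> stage) \<Rightarrow> omega1 \<Rightarrow> bool" where
  "correct c A g \<delta> \<longleftrightarrow>
     (arity (g \<delta>) \<noteq> 0 \<longrightarrow>
        converging g \<delta> (arity (g \<delta>)) (seq (g \<delta>)) \<and> (\<forall>i. c (seq (g \<delta>) i) \<in> A \<delta>)) \<and>
     ((\<exists>n f. n \<noteq> 0 \<and> converging g \<delta> n f \<and> (\<forall>i. c (f i) \<in> A \<delta>)) \<longrightarrow> arity (g \<delta>) \<noteq> 0) \<and>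
     finite (exempt (g \<delta>)) \<and>
     (\<forall>\<gamma>\<in>{..\<delta>} - exempt (g \<delta>). realizes (g \<gamma>) (bits (g \<delta>))) \<and>
     (bits (g \<delta>) \<inter> A \<delta> = {} \<or>
      (\<exists>\<gamma>\<le>\<delta>. \<exists>j<arity (g \<gamma>). (\<forall>i. seq (g \<gamma>) i ! j < \<gamma>) \<and>
         (\<exists>\<^sub>F i in sequentially. seq (g \<gamma>) i ! j \<in> A \<delta>) \<and>
         (\<forall>\<xi>\<in>bits (g \<delta>) \<inter> {..<\<gamma>}. \<forall>\<^sub>F i in sequentially. \<xi> \<in> bits (g (seq (g \<gamma>) i ! j)))))"

section \<open>Dependence of the conditions on earlier stages only\<close>

lemma converging_cong:
  assumes "\<And>\<gamma>. \<gamma> < \<delta> \<Longrightarrow> g \<gamma> = h \<gamma>"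
  shows "converging g \<delta> n f \<longleftrightarrow> converging h \<delta> n f"
proof -
  have "converging h \<delta> n f"
    if "\<And>\<gamma>. \<gamma> < \<delta> \<Longrightarrow> g \<gamma> = h \<gamma>" and *: "converging g \<delta> n f" for g h
  proof -
    have f: "length (f i) = n" "set (f i) \<subseteq> {..<\<delta>}" for i
      using * by (simp_all add: converging_def)
    have "h (f i ! j) = g (f i ! j)" if "j < n" for i j
    proof -
      have "f i ! j \<in> set (f i)" using f(1) that by simp
      with f(2) show ?thesis using \<open>\<And>\<gamma>. \<gamma> < \<delta> \<Longrightarrow> g \<gamma> = h \<gamma>\<close> by (metis lessThan_iff subsetD)
    qed
    with that show ?thesis unfolding converging_def by simp
  qed
  from this[of g h] this[of h g] assms show ?thesis by metis
qed

text \<open>The accumulation clause evaluates \<open>g\<close> at entries of a fixed sequence; its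
  conjunct \<open>seq (g \<gamma>) i ! j < \<gamma>\<close> keeps these below
  \<open>\<delta>\<close> without appeal to correctness of stage \<open>\<gamma>\<close>.\<close>

lemma correct_cong:
  assumes "\<And>\<gamma>. \<gamma> \<le> \<delta> \<Longrightarrow> g \<gamma> = h \<gamma>"
  shows "correct c A g \<delta> \<longleftrightarrow> correct c A h \<delta>"
proof -
  have *: "converging g \<delta> n f \<longleftrightarrow> converging h \<delta> n f" for n f
    using assms by (intro converging_cong) simp
  have "correct c A h \<delta>"
    if eq: "\<And>\<gamma>. \<gamma> \<le> \<delta> \<Longrightarrow> g \<gamma> = h \<gamma>" and c: "correct c A g \<delta>"
      and *: "\<And>n f. converging g \<delta> n f \<longleftrightarrow> converging h \<delta> n f" for g h
  proof -
    have "bits (h \<delta>) \<inter> A \<delta> = {} \<or>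
      (\<exists>\<gamma>\<le>\<delta>. \<exists>j<arity (h \<gamma>). (\<forall>i. seq (h \<gamma>) i ! j < \<gamma>) \<and>
         (\<exists>\<^sub>F i in sequentially. seq (h \<gamma>) i ! j \<in> A \<delta>) \<and>
         (\<forall>\<xi>\<in>bits (h \<delta>) \<inter> {..<\<gamma>}. \<forall>\<^sub>F i in sequentially. \<xi> \<in> bits (h (seq (h \<gamma>) i ! j))))"
    proof (cases "bits (g \<delta>) \<inter> A \<delta> = {}")
      case True
      then show ?thesis using eq by simp
    next
      case False
      with c obtain \<gamma> j where \<gamma>: "\<gamma> \<le> \<delta>" "j < arity (g \<gamma>)" "\<forall>i. seq (g \<gamma>) i ! j < \<gamma>"
        "\<exists>\<^sub>F i in sequentially. seq (g \<gamma>) i ! j \<in> A \<delta>"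
        "\<forall>\<xi>\<in>bits (g \<delta>) \<inter> {..<\<gamma>}. \<forall>\<^sub>F i in sequentially. \<xi> \<in> bits (g (seq (g \<gamma>) i ! j))"
        unfolding correct_def by auto
      have "h (seq (g \<gamma>) i ! j) = g (seq (g \<gamma>) i ! j)" for i
        using \<gamma> eq by (metis less_imp_le order_trans)
      then show ?thesis
        using \<gamma> eq[OF \<gamma>(1)] eq[OF order_refl] by (intro disjI2 exI[of _ \<gamma>] conjI exI[of _ j]) auto
    qed
    moreover have "arity (h \<delta>) \<noteq> 0 \<longrightarrow>
        converging h \<delta> (arity (h \<delta>)) (seq (h \<delta>)) \<and> (\<forall>i. c (seq (h \<delta>) i) \<in> A \<delta>)"
      "(\<exists>n f. n \<noteq> 0 \<and> converging h \<delta> n f \<and> (\<forall>i. c (f i) \<in> A \<delta>)) \<longrightarrow> arity (h \<delta>) \<noteq> 0"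
      "finite (exempt (h \<delta>))" "\<forall>\<gamma>\<in>{..\<delta>} - exempt (h \<delta>). realizes (h \<gamma>) (bits (h \<delta>))"
      using c eq unfolding correct_def * by auto
    ultimately show ?thesis unfolding correct_def by blast
  qed
  from this[of g h] this[of h g] assms * show ?thesis by metis
qed

section \<open>What convergence and correctness provide\<close>

lemma convergingD_limit:
  assumes "converging g \<delta> n f" "j < n"
  obtains L W where "L \<subseteq> {..<\<delta>}" "finite W" "\<And>\<gamma>. \<gamma> < \<delta> \<Longrightarrow> \<gamma> \<notin> W \<Longrightarrow> realizes (g \<gamma>) L"
    "\<And>\<xi>. \<xi> \<in> L \<Longrightarrow> \<forall>\<^sub>F i in sequentially. \<xi> \<in> bits (g (f i ! j))"
proof -
  have "\<forall>j<n. \<exists>L W. L \<subseteq> {..<\<delta>} \<and> finite W \<and> (\<forall>\<gamma>\<in>{..<\<delta>} - W. realizes (g \<gamma>) L) \<and>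
        (\<forall>\<xi>\<in>L. \<forall>\<^sub>F i in sequentially. \<xi> \<in> bits (g (f i ! j)))"
    using assms(1) unfolding converging_def by (elim conjE)
  with assms(2) obtain L W where "L \<subseteq> {..<\<delta>}" "finite W"
    "\<forall>\<gamma>\<in>{..<\<delta>} - W. realizes (g \<gamma>) L" "\<forall>\<xi>\<in>L. \<forall>\<^sub>F i in sequentially. \<xi> \<in> bits (g (f i ! j))"
    by (elim allE impE exE conjE)
  then show thesis by (intro that) blast+
qed

lemma correct_converging:
  "correct c A g \<delta> \<Longrightarrow> arity (g \<delta>) \<noteq> 0 \<Longrightarrow> converging g \<delta> (arity (g \<delta>)) (seq (g \<delta>))"
  unfolding correct_def by (elim conjE) simp

lemma correct_finite_exempt: "correct c A g \<delta> \<Longrightarrow> finite (exempt (g \<delta>))"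
  unfolding correct_def by (elim conjE)

lemma correct_realizes:
  assumes "correct c A g \<delta>" "\<gamma> \<le> \<delta>" "\<gamma> \<notin> exempt (g \<delta>)"
  shows "realizes (g \<gamma>) (bits (g \<delta>))"
proof -
  have "\<forall>\<gamma>\<in>{..\<delta>} - exempt (g \<delta>). realizes (g \<gamma>) (bits (g \<delta>))"
    using assms(1) unfolding correct_def by (elim conjE)
  with assms(2,3) show ?thesis by simp
qed

lemma correct_arity:
  assumes "correct c A g \<delta>" "n \<noteq> 0" "converging g \<delta> n f" "\<And>i. c (f i) \<in> A \<delta>"
  shows "arity (g \<delta>) \<noteq> 0"
proof -
  have "(\<exists>n f. n \<noteq> 0 \<and> converging g \<delta> n f \<and> (\<forall>i. c (f i) \<in> A \<delta>)) \<longrightarrow> arity (g \<delta>) \<noteq> 0"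
    using assms(1) unfolding correct_def by (elim conjE)
  with assms(2-4) show ?thesis by blast
qed

lemma correct_accumulation:
  assumes "correct c A g \<delta>" "bits (g \<delta>) \<inter> A \<delta> \<noteq> {}"
  obtains \<gamma> j where "\<gamma> \<le> \<delta>" "j < arity (g \<gamma>)" "\<And>i. seq (g \<gamma>) i ! j < \<gamma>"
    "\<exists>\<^sub>F i in sequentially. seq (g \<gamma>) i ! j \<in> A \<delta>"
    "\<And>\<xi>. \<xi> \<in> bits (g \<delta>) \<Longrightarrow> \<xi> < \<gamma> \<Longrightarrow> \<forall>\<^sub>F i in sequentially. \<xi> \<in> bits (g (seq (g \<gamma>) i ! j))"
proof -
  have "\<exists>\<gamma>\<le>\<delta>. \<exists>j<arity (g \<gamma>). (\<forall>i. seq (g \<gamma>) i ! j < \<gamma>) \<and>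
         (\<exists>\<^sub>F i in sequentially. seq (g \<gamma>) i ! j \<in> A \<delta>) \<and>
         (\<forall>\<xi>\<in>bits (g \<delta>) \<inter> {..<\<gamma>}. \<forall>\<^sub>F i in sequentially. \<xi> \<in> bits (g (seq (g \<gamma>) i ! j)))"
    using assms unfolding correct_def by (elim conjE disjE) simp_all
  then show thesis by (elim exE conjE) (intro that; blast)
qed

lemma correct_seq:
  assumes "correct c A g \<delta>" "arity (g \<delta>) \<noteq> 0"
  shows "length (seq (g \<delta>) i) = arity (g \<delta>)" "distinct (seq (g \<delta>) i)"
    "set (seq (g \<delta>) i) \<subseteq> {..<\<delta>}" "c (seq (g \<delta>) i) \<in> A \<delta>"
proof -
  have "\<forall>i. length (seq (g \<delta>) i) = arity (g \<delta>) \<and> distinct (seq (g \<delta>) i) \<and> set (seq (g \<delta>) i) \<subseteq> {..<\<delta>}"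
    using correct_converging[OF assms] unfolding converging_def by (elim conjE)
  then show "length (seq (g \<delta>) i) = arity (g \<delta>)" "distinct (seq (g \<delta>) i)"
    "set (seq (g \<delta>) i) \<subseteq> {..<\<delta>}" by simp_all
  show "c (seq (g \<delta>) i) \<in> A \<delta>"
    using assms unfolding correct_def by (elim conjE) simp
qed

section \<open>Realizing countably many sequences, and the recursion\<close>

text \<open>Along an enumeration of \<open>C\<close>, pick for each \<open>p\<close> a list that
  misses \<open>A\<close> and all lists picked before. The picked lists are then pairwise disjoint,
  so membership in \<open>H\<close> can be prescribed on each of them independently.\<close>

lemma simultaneous_realization:
  fixes q :: "'p \<Rightarrow> nat \<Rightarrow> 'a list" and b :: "'p \<Rightarrow> bool list"
  assumes "countable C" "L \<subseteq> A"
    and esc: "\<And>p S. p \<in> C \<Longrightarrow> finite S \<Longrightarrow> \<exists>i. set (q p i) \<inter> (S \<union> A) = {}"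
    and dist: "\<And>p i. p \<in> C \<Longrightarrow> distinct (q p i)"
  obtains H where "H \<inter> A = L"
    "\<And>p. p \<in> C \<Longrightarrow> \<exists>i. \<forall>k<length (q p i). (q p i ! k \<in> H) = b p ! k"
proof (cases "C = {}")
  case True
  then show thesis using that[of L] assms(2) by blast
next
  case False
  \<comment> \<open>The enumeration may repeat; a \<open>p\<close> that occurs several times gets
    several disjoint lists, each of which serves.\<close>
  define e where "e = from_nat_into C"
  have e: "e m \<in> C" for m unfolding e_def using False by (rule from_nat_into)
  let ?P = "\<lambda>s m i. set (q (e m) i) \<inter> ((\<Union>m'<m. set (q (e m') (s m'))) \<union> A) = {}"
  have "\<exists>s. \<forall>m. ?P s m (s m)"
  proof (rule dependent_wellorder_choice)
    show "?P f m r = ?P g m r" if "\<And>y. y < m \<Longrightarrow> f y = g y" for r m and f g :: "nat \<Rightarrow> nat"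
      using that by auto
    show "\<exists>i. ?P f m i" for m f
      by (rule esc[OF e]) simp
  qed
  then obtain s where s: "\<And>m. ?P s m (s m)" by blast
  define l where "l m = q (e m) (s m)" for m
  have disj: "set (l m) \<inter> set (l m') = {}" if "m' < m" for m m'
    using s[of m] that by (fastforce simp: l_def)
  have lA: "set (l m) \<inter> A = {}" for m
    using s[of m] by (auto simp: l_def)
  have inj: "m = m'" if "x \<in> set (l m)" "x \<in> set (l m')" for x m m'
    using disj[of m m'] disj[of m' m] that by (cases m m' rule: linorder_cases) auto
  define H where "H = L \<union> {l m ! k | m k. k < length (l m) \<and> b (e m) ! k}"
  show thesis
  proof (rule that)
    show "H \<inter> A = L" using lA assms(2) by (auto simp: H_def dest: nth_mem)
    fix p assume "p \<in> C"
    then obtain m where m: "p = e m"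
      using assms(1) unfolding e_def by (metis from_nat_into_surj)
    have "(l m ! k \<in> H) = b (e m) ! k" if k: "k < length (l m)" for k
    proof
      assume "l m ! k \<in> H"
      moreover have "l m ! k \<notin> L" using lA[of m] assms(2) nth_mem[OF k] by blast
      ultimately obtain m' k' where *: "l m ! k = l m' ! k'" "k' < length (l m')" "b (e m') ! k'"
        by (auto simp: H_def)
      then have "m = m'" using inj k by (metis nth_mem)
      moreover have "distinct (l m)" using dist e by (simp add: l_def)
      ultimately show "b (e m) ! k" using * k by (metis nth_eq_iff_index_eq)
    qed (use k in \<open>auto simp: H_def\<close>)
    then show "\<exists>i. \<forall>k<length (q p i). (q p i ! k \<in> H) = b p ! k"
      unfolding m l_def by blast
  qed
qed

text \<open>The entries tend to \<open>\<delta>\<close> from below, so each ordinal is eventually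
  left behind or never met.\<close>

lemma converging_escapes:
  assumes "converging g \<delta> n f" "finite S"
  shows "\<forall>\<^sub>F i in sequentially. set (f i) \<inter> S = {}"
proof -
  have "\<forall>\<^sub>F i in sequentially. x \<notin> set (f i)" for x
  proof (cases "x < \<delta>")
    case True
    then have "\<forall>\<^sub>F i in sequentially. \<forall>\<alpha>\<in>set (f i). x < \<alpha>"
      using assms(1) by (simp add: converging_def)
    then show ?thesis by eventually_elim auto
  next
    case False
    then have "x \<notin> set (f i)" for i
      using assms(1) by (auto simp: converging_def)
    then show ?thesis by simp
  qed
  then have "\<forall>\<^sub>F i in sequentially. \<forall>x\<in>S. x \<notin> set (f i)"
    using assms(2) by (simp add: eventually_ball_finite)
  then show ?thesis by eventually_elim auto
qed

text \<open>\<open>A\<close> is the region where \<open>H\<close> is prescribed. It will be the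
  guess, with \<open>L\<close> empty, or an initial segment, with \<open>L\<close> a limit
  set.\<close>

lemma ex_realizes_countably_many:
  fixes G :: "omega1 set"
  assumes "countable G" "L \<subseteq> A"
    and conv: "\<And>\<gamma>. \<gamma> \<in> G \<Longrightarrow> arity (g \<gamma>) \<noteq> 0 \<Longrightarrow> converging g \<gamma> (arity (g \<gamma>)) (seq (g \<gamma>))"
    and avoid: "\<And>\<gamma>. \<gamma> \<in> G \<Longrightarrow> arity (g \<gamma>) \<noteq> 0 \<Longrightarrow>
      \<forall>\<^sub>F i in sequentially. set (seq (g \<gamma>) i) \<inter> A = {}"
  obtains H where "H \<inter> A = L" "\<And>\<gamma>. \<gamma> \<in> G \<Longrightarrow> realizes (g \<gamma>) H"
proof -
  \<comment> \<open>Each pair of a stage and a pattern receives its own list, so that every pattern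
    occurs.\<close>
  define C where "C = (SIGMA \<gamma>:{\<gamma>\<in>G. arity (g \<gamma>) \<noteq> 0}. {b :: bool list. length b = arity (g \<gamma>)})"
  have "countable C"
    unfolding C_def using assms(1) by (intro countable_SIGMA) auto
  moreover have "\<exists>i. set (seq (g (fst p)) i) \<inter> (S \<union> A) = {}" if "p \<in> C" "finite S" for p S
  proof -
    have "\<forall>\<^sub>F i in sequentially. set (seq (g (fst p)) i) \<inter> A = {}"
      "\<forall>\<^sub>F i in sequentially. set (seq (g (fst p)) i) \<inter> S = {}"
      using that avoid converging_escapes[OF conv] by (auto simp: C_def)
    then have "\<forall>\<^sub>F i in sequentially. set (seq (g (fst p)) i) \<inter> (S \<union> A) = {}"
      by eventually_elim auto
    then show ?thesis by (meson eventually_happens sequentially_bot)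
  qed
  moreover have "distinct (seq (g (fst p)) i)" "length (seq (g (fst p)) i) = arity (g (fst p))"
    if "p \<in> C" for p i
    using that conv by (auto simp: C_def converging_def)
  ultimately obtain H where H: "H \<inter> A = L" "\<And>p. p \<in> C \<Longrightarrow>
      \<exists>i. \<forall>k<arity (g (fst p)). (seq (g (fst p)) i ! k \<in> H) = snd p ! k"
    using simultaneous_realization[of C L A "\<lambda>p. seq (g (fst p))" snd] assms(2) by metis
  have "realizes (g \<gamma>) H" if "\<gamma> \<in> G" for \<gamma>
  proof (cases "arity (g \<gamma>) = 0")
    case False
    then show ?thesis
      using H(2)[of "(\<gamma>, b)" for b] that by (simp add: realizes_def C_def)
  qed (simp add: realizes_def)
  with H(1) show thesis using that by blast
qed

text \<open>First the sequence at \<open>\<delta>\<close> is fixed, then the bits. The sequence just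
  fixed counts among those to be realized, and may itself be the one that meets the guess infinitely
  often.\<close>

lemma correct_extension:
  assumes IH: "\<And>\<gamma>. \<gamma> < \<delta> \<Longrightarrow> correct c A g \<gamma>"
  shows "\<exists>r. correct c A (g(\<delta> := r)) \<delta>"
proof -
  let ?good = "\<lambda>n f. n \<noteq> 0 \<and> converging g \<delta> n f \<and> (\<forall>i. c (f i) \<in> A \<delta>)"
  obtain n f where nf: "?good n f \<or> n = 0" "(\<exists>n f. ?good n f) \<longrightarrow> n \<noteq> 0"
    by blast
  \<comment> \<open>Arities and sequences do not depend on \<open>H\<close> and \<open>V\<close>, so
    \<open>h {} {}\<close> represents them before the bits are known.\<close>
  define h where "h = (\<lambda>H V. g(\<delta> := Stage n f H V))"
  have h: "converging (h H V) \<gamma> m p \<longleftrightarrow> converging g \<gamma> m p" if "\<gamma> \<le> \<delta>" for H V \<gamma> m p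
    using that by (intro converging_cong) (auto simp: h_def)
  have conv: "converging g \<gamma> (arity (h H V \<gamma>)) (seq (h H V \<gamma>))"
    if "\<gamma> \<le> \<delta>" "arity (h H V \<gamma>) \<noteq> 0" for \<gamma> H V
    using that nf(1) IH[of \<gamma>] by (cases "\<gamma> = \<delta>") (auto simp: h_def correct_def)
  have realizes_h: "realizes (h H V \<gamma>) = realizes (h {} {} \<gamma>)" for H V \<gamma>
    by (intro ext) (simp add: h_def realizes_def)
  have correct_h: "correct c A (h H V) \<delta>"
    if "finite V" "\<And>\<gamma>. \<gamma> \<le> \<delta> \<Longrightarrow> \<gamma> \<notin> V \<Longrightarrow> realizes (h {} {} \<gamma>) H"
      and "H \<inter> A \<delta> = {} \<or>
      (\<exists>\<gamma>\<le>\<delta>. \<exists>j<arity (h {} {} \<gamma>). (\<forall>i. seq (h {} {} \<gamma>) i ! j < \<gamma>) \<and>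
         (\<exists>\<^sub>F i in sequentially. seq (h {} {} \<gamma>) i ! j \<in> A \<delta>) \<and>
         (\<forall>\<xi>\<in>H \<inter> {..<\<gamma>}. \<forall>\<^sub>F i in sequentially. \<xi> \<in> bits (g (seq (h {} {} \<gamma>) i ! j))))"
    for H V
  proof -
    have h_below: "h H V \<gamma> = g \<gamma>" if "\<gamma> < \<delta>" for \<gamma>
      using that by (auto simp: h_def)
    have seq_h: "seq (h H V \<gamma>) = seq (h {} {} \<gamma>)" "arity (h H V \<gamma>) = arity (h {} {} \<gamma>)" for \<gamma>
      by (simp_all add: h_def)
    have fields: "bits (h H V \<delta>) = H" "exempt (h H V \<delta>) = V" "arity (h H V \<delta>) = n" "seq (h H V \<delta>) = f"
      by (simp_all add: h_def)
    have "converging (h H V) \<delta> m p \<longleftrightarrow> converging g \<delta> m p" for m p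
      by (rule h) simp
    then have "n \<noteq> 0 \<longrightarrow> converging (h H V) \<delta> n f \<and> (\<forall>i. c (f i) \<in> A \<delta>)"
      "(\<exists>n f. n \<noteq> 0 \<and> converging (h H V) \<delta> n f \<and> (\<forall>i. c (f i) \<in> A \<delta>)) \<longrightarrow> n \<noteq> 0"
      using nf by metis+
    moreover have "\<forall>\<gamma>\<in>{..\<delta>} - V. realizes (h H V \<gamma>) H"
      using that(2) unfolding realizes_h[of H V] by simp
    moreover have "H \<inter> A \<delta> = {} \<or>
      (\<exists>\<gamma>\<le>\<delta>. \<exists>j<arity (h H V \<gamma>). (\<forall>i. seq (h H V \<gamma>) i ! j < \<gamma>) \<and>
         (\<exists>\<^sub>F i in sequentially. seq (h H V \<gamma>) i ! j \<in> A \<delta>) \<and>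
         (\<forall>\<xi>\<in>H \<inter> {..<\<gamma>}. \<forall>\<^sub>F i in sequentially. \<xi> \<in> bits (h H V (seq (h H V \<gamma>) i ! j))))"
    proof (cases "H \<inter> A \<delta> = {}")
      case False
      with that(3) obtain \<gamma> j where \<gamma>: "\<gamma> \<le> \<delta>" "j < arity (h {} {} \<gamma>)" "\<forall>i. seq (h {} {} \<gamma>) i ! j < \<gamma>"
        "\<exists>\<^sub>F i in sequentially. seq (h {} {} \<gamma>) i ! j \<in> A \<delta>"
        "\<forall>\<xi>\<in>H \<inter> {..<\<gamma>}. \<forall>\<^sub>F i in sequentially. \<xi> \<in> bits (g (seq (h {} {} \<gamma>) i ! j))"
        by blast
      then have "h H V (seq (h {} {} \<gamma>) i ! j) = g (seq (h {} {} \<gamma>) i ! j)" for i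
        by (intro h_below) (meson less_le_trans)
      with \<gamma> have "\<forall>\<xi>\<in>H \<inter> {..<\<gamma>}. \<forall>\<^sub>F i in sequentially. \<xi> \<in> bits (h H V (seq (h {} {} \<gamma>) i ! j))"
        by simp
      with \<gamma> show ?thesis unfolding seq_h by blast
    qed simp
    ultimately show ?thesis
      unfolding correct_def fields using \<open>finite V\<close> by blast
  qed
  show ?thesis
  proof (cases "\<forall>\<gamma>\<le>\<delta>. arity (h {} {} \<gamma>) \<noteq> 0 \<longrightarrow>
      (\<forall>\<^sub>F i in sequentially. set (seq (h {} {} \<gamma>) i) \<inter> A \<delta> = {})")
    case True
    obtain H where "H \<inter> A \<delta> = {}" "\<And>\<gamma>. \<gamma> \<in> {..\<delta>} \<Longrightarrow> realizes (h {} {} \<gamma>) H"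
    proof (rule ex_realizes_countably_many[of "{..\<delta>}" "{}" "A \<delta>" "h {} {}"])
      fix \<gamma> assume "\<gamma> \<in> {..\<delta>}" "arity (h {} {} \<gamma>) \<noteq> 0"
      then show "converging (h {} {}) \<gamma> (arity (h {} {} \<gamma>)) (seq (h {} {} \<gamma>))"
        "\<forall>\<^sub>F i in sequentially. set (seq (h {} {} \<gamma>) i) \<inter> A \<delta> = {}"
        using True conv h by auto
    qed (use countable_atMost_omega1 in auto)
    then have "correct c A (h H {}) \<delta>" by (intro correct_h) auto
    then show ?thesis unfolding h_def by (rule exI)
  next
    case False
    let ?q = "\<lambda>\<gamma>. seq (h {} {} \<gamma>)"
    from False obtain \<gamma> where \<gamma>: "\<gamma> \<le> \<delta>" "arity (h {} {} \<gamma>) \<noteq> 0"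
      and fr: "\<exists>\<^sub>F i in sequentially. set (?q \<gamma> i) \<inter> A \<delta> \<noteq> {}"
      by (auto simp: frequently_def)
    note conv\<gamma> = conv[OF \<gamma>]
    \<comment> \<open>Pigeonhole: some single position meets \<open>A \<delta>\<close> infinitely
      often.\<close>
    have "\<exists>\<^sub>F i in sequentially. \<exists>j\<in>{..<arity (h {} {} \<gamma>)}. ?q \<gamma> i ! j \<in> A \<delta>"
      using fr
    proof (rule frequently_elim1)
      fix i assume "set (?q \<gamma> i) \<inter> A \<delta> \<noteq> {}"
      then obtain j where "j < length (?q \<gamma> i)" "?q \<gamma> i ! j \<in> A \<delta>"
        by (auto simp: in_set_conv_nth)
      then show "\<exists>j\<in>{..<arity (h {} {} \<gamma>)}. ?q \<gamma> i ! j \<in> A \<delta>"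
        using conv\<gamma> by (auto simp: converging_def)
    qed
    from frequently_bex_finite[OF finite_lessThan this] obtain j
      where j: "j < arity (h {} {} \<gamma>)" "\<exists>\<^sub>F i in sequentially. ?q \<gamma> i ! j \<in> A \<delta>"
      by blast
    obtain L W where L: "L \<subseteq> {..<\<gamma>}" "finite W"
      "\<And>\<beta>. \<beta> < \<gamma> \<Longrightarrow> \<beta> \<notin> W \<Longrightarrow> realizes (g \<beta>) L"
      "\<And>\<xi>. \<xi> \<in> L \<Longrightarrow> \<forall>\<^sub>F i in sequentially. \<xi> \<in> bits (g (?q \<gamma> i ! j))"
      using convergingD_limit[OF conv\<gamma> j(1)] by blast
    have lt: "?q \<beta> i ! k < \<beta>" if "\<beta> \<le> \<delta>" "k < arity (h {} {} \<beta>)" for \<beta> i k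
    proof -
      have "length (?q \<beta> i) = arity (h {} {} \<beta>)" "set (?q \<beta> i) \<subseteq> {..<\<beta>}"
        using conv[of \<beta> "{}" "{}"] that by (auto simp: converging_def)
      then show ?thesis using that(2) by (metis lessThan_iff nth_mem subsetD)
    qed
    \<comment> \<open>Sequences fixed after \<open>\<gamma>\<close> eventually lie above
      \<open>\<gamma>\<close>, so they can be realized while \<open>H\<close> is held equal to
      \<open>L\<close> below \<open>\<gamma>\<close>.\<close>
    have "countable {\<gamma><..\<delta>}"
      by (rule countable_subset[OF _ countable_atMost_omega1]) auto
    then obtain H where H: "H \<inter> {..<\<gamma>} = L" "\<And>\<beta>. \<beta> \<in> {\<gamma><..\<delta>} \<Longrightarrow> realizes (h {} {} \<beta>) H"
    proof (rule ex_realizes_countably_many[of _ L "{..<\<gamma>}" "h {} {}"])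
      fix \<beta> assume \<beta>: "\<beta> \<in> {\<gamma><..\<delta>}" "arity (h {} {} \<beta>) \<noteq> 0"
      then show c\<beta>: "converging (h {} {}) \<beta> (arity (h {} {} \<beta>)) (?q \<beta>)"
        using conv h by auto
      have "\<forall>\<^sub>F i in sequentially. \<forall>\<alpha>\<in>set (?q \<beta> i). \<gamma> < \<alpha>"
        using c\<beta> \<beta> unfolding converging_def by simp
      then show "\<forall>\<^sub>F i in sequentially. set (?q \<beta> i) \<inter> {..<\<gamma>} = {}"
        by eventually_elim auto
    qed (use L in auto)
    \<comment> \<open>Stages below \<open>\<gamma>\<close> and outside \<open>W\<close> are realized
      by \<open>L\<close> already, and \<open>H\<close> agrees with \<open>L\<close> on their
      entries. Stage \<open>\<gamma>\<close> is exempt: its entries lie below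
      \<open>\<gamma>\<close>, where \<open>H\<close> is forced to be \<open>L\<close>.\<close>
    have "realizes (h {} {} \<beta>) H" if "\<beta> \<le> \<delta>" "\<beta> \<notin> insert \<gamma> W" for \<beta>
    proof (cases "\<beta> < \<gamma>")
      case True
      have "realizes (h {} {} \<beta>) L" using L(3)[of \<beta>] True that \<gamma> by (auto simp: h_def)
      moreover have "(?q \<beta> i ! k \<in> L) = (?q \<beta> i ! k \<in> H)" if "k < arity (h {} {} \<beta>)" for i k
        using lt[OF \<open>\<beta> \<le> \<delta>\<close> that, of i] True H(1) by auto
      ultimately show ?thesis by (simp add: realizes_def)
    qed (use H that in auto)
    moreover have "\<forall>\<xi>\<in>H \<inter> {..<\<gamma>}. \<forall>\<^sub>F i in sequentially. \<xi> \<in> bits (g (?q \<gamma> i ! j))"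
      using L(4) unfolding H(1) by blast
    ultimately have "correct c A (h H (insert \<gamma> W)) \<delta>"
      using L(2) \<gamma>(1) j lt[OF \<gamma>(1) j(1)] by (intro correct_h) blast+
    then show ?thesis unfolding h_def by (rule exI)
  qed
qed

text \<open>Writing the condition for \<open>g(\<delta> := r)\<close> separates the new stage from
  the earlier ones, as well-founded choice requires; the update by \<open>g \<delta>\<close> itself
  disappears at the end.\<close>

lemma ex_correct: "\<exists>g. \<forall>\<delta>. correct c A g \<delta>"
proof -
  have "\<exists>g. \<forall>\<delta>. correct c A (g(\<delta> := g \<delta>)) \<delta>"
  proof (rule dependent_wellorder_choice)
    show "correct c A (f(\<delta> := r)) \<delta> = correct c A (g(\<delta> := r)) \<delta>"
      if "\<And>y. y < \<delta> \<Longrightarrow> f y = g y" for r f g \<delta>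
      using that by (intro correct_cong) (auto simp: le_less)
    show "\<exists>r. correct c A (g(\<delta> := r)) \<delta>"
      if "\<And>\<gamma>. \<gamma> < \<delta> \<Longrightarrow> correct c A (g(\<gamma> := g \<gamma>)) \<gamma>" for \<delta> g
      using that by (intro correct_extension) simp
  qed
  then show ?thesis by simp
qed

section \<open>Reflection: uncountable families yield converging sequences\<close>

text \<open>Any finitely many positive facts about the bits at the entries of \<open>l0\<close> are
  shared by a member of \<open>\<L>\<close> below \<open>\<eta>\<close>. Diagonalizing along an
  enumeration of \<open>\<eta>\<close> gives a sequence whose limit sets are the traces of those
  bits on \<open>\<eta>\<close>.\<close>

lemma ex_converging:
  assumes correct: "\<And>\<delta>. correct c A g \<delta>"
    and \<L>: "\<And>l. l \<in> \<L> \<Longrightarrow> length l = n \<and> distinct l"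
    and \<psi>: "\<And>\<zeta>. \<zeta> < \<eta> \<Longrightarrow> \<psi> \<zeta> < \<eta>"
    and reflect: "\<And>\<zeta> K l. finite K \<Longrightarrow> K \<subseteq> {..<n} \<times> {..\<zeta>} \<Longrightarrow> l \<in> \<L> \<Longrightarrow>
      \<forall>\<alpha>\<in>set l. \<zeta> < \<alpha> \<Longrightarrow> \<forall>(j, \<xi>)\<in>K. \<xi> \<in> bits (g (l ! j)) \<Longrightarrow>
      \<exists>l'\<in>\<L>. (\<forall>\<alpha>\<in>set l'. \<zeta> < \<alpha> \<and> \<alpha> < \<psi> \<zeta>) \<and> c l' < \<psi> \<zeta> \<and> (\<forall>(j, \<xi>)\<in>K. \<xi> \<in> bits (g (l' ! j)))"
    and l0: "l0 \<in> \<L>" "\<And>\<alpha>. \<alpha> \<in> set l0 \<Longrightarrow> \<eta> \<le> \<alpha>"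
    and "{..<\<eta>} \<noteq> {}"
  obtains f where "converging g \<eta> n f" "\<And>i. f i \<in> \<L>" "\<And>i. c (f i) < \<eta>"
proof -
  define e where "e = from_nat_into {..<\<eta>}"
  have e: "e i < \<eta>" for i
    using from_nat_into[OF \<open>{..<\<eta>} \<noteq> {}\<close>] by (simp add: e_def)
  have e_surj: "\<exists>i. e i = \<zeta>" if "\<zeta> < \<eta>" for \<zeta>
    using from_nat_into_surj[OF countable_lessThan_omega1] that by (auto simp: e_def)
  \<comment> \<open>The \<open>i\<close>-th list must lie above the first \<open>i + 1\<close>
    enumerated ordinals and share all positive facts about them.\<close>
  define m where "m i = Max (e ` {..i})" for i
  define K where "K i = {(j, \<xi>). j < n \<and> \<xi> \<in> e ` {..i} \<and> \<xi> \<in> bits (g (l0 ! j))}" for i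
  have m: "m i < \<eta>" "k \<le> i \<Longrightarrow> e k \<le> m i" for i k
    using e by (auto simp: m_def)
  have "\<exists>l'\<in>\<L>. (\<forall>\<alpha>\<in>set l'. m i < \<alpha> \<and> \<alpha> < \<psi> (m i)) \<and> c l' < \<psi> (m i) \<and>
      (\<forall>(j, \<xi>)\<in>K i. \<xi> \<in> bits (g (l' ! j)))" for i
  proof (rule reflect)
    have "K i \<subseteq> {..<n} \<times> e ` {..i}" by (auto simp: K_def)
    then show "finite (K i)" by (rule finite_subset) simp
    show "K i \<subseteq> {..<n} \<times> {..m i}" using m(2) by (auto simp: K_def)
    show "\<forall>\<alpha>\<in>set l0. m i < \<alpha>" using l0(2) m(1) by (meson less_le_trans)
    show "\<forall>(j, \<xi>)\<in>K i. \<xi> \<in> bits (g (l0 ! j))" by (auto simp: K_def)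
  qed (rule l0)
  then obtain f where f: "\<And>i. f i \<in> \<L>" "\<And>i \<alpha>. \<alpha> \<in> set (f i) \<Longrightarrow> m i < \<alpha> \<and> \<alpha> < \<psi> (m i)"
    "\<And>i. c (f i) < \<psi> (m i)" "\<And>i j \<xi>. (j, \<xi>) \<in> K i \<Longrightarrow> \<xi> \<in> bits (g (f i ! j))"
    by (metis (no_types, lifting) case_prodD)
  have below: "\<psi> (m i) < \<eta>" for i using \<psi> m(1) by simp
  have "converging g \<eta> n f"
    unfolding converging_def
  proof (intro conjI allI impI)
    fix i
    show "length (f i) = n" "distinct (f i)" using \<L> f(1) by auto
    show "set (f i) \<subseteq> {..<\<eta>}" using f(2) below less_trans by blast
  next
    fix \<zeta> assume "\<zeta> < \<eta>"
    then obtain k where "e k = \<zeta>" using e_surj by blast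
    then show "\<forall>\<^sub>F i in sequentially. \<forall>\<alpha>\<in>set (f i). \<zeta> < \<alpha>"
      unfolding eventually_sequentially using m(2) f(2) by (meson le_less_trans)
  next
    fix j assume j: "j < n"
    define L where "L = bits (g (l0 ! j)) \<inter> {..<\<eta>}"
    have "\<eta> \<le> l0 ! j" using l0 \<L> j by auto
    show "\<exists>L W. L \<subseteq> {..<\<eta>} \<and> finite W \<and> (\<forall>\<gamma>\<in>{..<\<eta>} - W. realizes (g \<gamma>) L) \<and>
        (\<forall>\<xi>\<in>L. \<forall>\<^sub>F i in sequentially. \<xi> \<in> bits (g (f i ! j)))"
    proof (intro exI conjI ballI)
      show "L \<subseteq> {..<\<eta>}" by (simp add: L_def)
      \<comment> \<open>The exceptions of \<open>L\<close> are those of stage \<open>l0 ! j\<close>,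
        which lies at or above \<open>\<eta>\<close> and so handles every \<open>\<gamma>\<close>
        below \<open>\<eta>\<close>. Cutting at \<open>\<eta>\<close> is harmless since entries at
        stage \<open>\<gamma>\<close> are below \<open>\<gamma>\<close>.\<close>
      show "finite (exempt (g (l0 ! j)))" using correct by (rule correct_finite_exempt)
      fix \<gamma> assume \<gamma>: "\<gamma> \<in> {..<\<eta>} - exempt (g (l0 ! j))"
      then have r: "realizes (g \<gamma>) (bits (g (l0 ! j)))"
        using \<open>\<eta> \<le> l0 ! j\<close> by (intro correct_realizes[OF correct]) auto
      have "seq (g \<gamma>) i ! k < \<eta>" if "k < arity (g \<gamma>)" for i k
      proof -
        have "seq (g \<gamma>) i ! k \<in> set (seq (g \<gamma>) i)"
          using correct_seq(1)[OF correct, of \<gamma> i] that by simp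
        then show ?thesis
          using correct_seq(3)[OF correct, of \<gamma> i] that \<gamma> by fastforce
      qed
      then show "realizes (g \<gamma>) L" using r by (simp add: realizes_def L_def)
    next
      fix \<xi> assume "\<xi> \<in> L"
      then obtain k where "e k = \<xi>" "\<xi> \<in> bits (g (l0 ! j))" using e_surj by (auto simp: L_def)
      then have "(j, \<xi>) \<in> K i" if "k \<le> i" for i using that j by (auto simp: K_def)
      then show "\<forall>\<^sub>F i in sequentially. \<xi> \<in> bits (g (f i ! j))"
        unfolding eventually_sequentially using f(4) by blast
    qed
  qed
  moreover have "c (f i) < \<eta>" for i
    using f(3) below by (rule less_trans)
  ultimately show thesis using f(1) by (intro that)
qed

text \<open>For fixed \<open>\<zeta>\<close> there are only countably many finite \<open>K\<close>.
  One witness for each, chosen independently of \<open>l\<close>, gives countably many ordinals,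
  which have a common bound.\<close>

lemma ex_reflection_function:
  fixes \<L> :: "omega1 list set" and c :: "omega1 list \<Rightarrow> omega1"
    and P :: "omega1 \<Rightarrow> (nat \<times> omega1) set \<Rightarrow> omega1 list \<Rightarrow> bool"
  shows "\<exists>\<psi>. \<forall>\<zeta> K. \<forall>l\<in>\<L>. finite K \<and> K \<subseteq> {..<n} \<times> {..\<zeta>} \<and> P \<zeta> K l \<longrightarrow>
    (\<exists>l'\<in>\<L>. P \<zeta> K l' \<and> c l' < \<psi> \<zeta> \<and> (\<forall>\<alpha>\<in>set l'. \<alpha> < \<psi> \<zeta>))"
proof (rule choice, rule)
  fix \<zeta> :: omega1
  let ?\<K> = "{K. finite K \<and> K \<subseteq> {..<n} \<times> {..\<zeta>}}"
  define w where "w K = (SOME l. l \<in> \<L> \<and> P \<zeta> K l)" for K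
  have "countable ?\<K>"
    by (intro countable_Collect_finite_subset countable_SIGMA countable_atMost_omega1) auto
  then have "countable (\<Union>K\<in>?\<K>. insert (c (w K)) (set (w K)))"
    by (rule countable_UN) (simp add: countable_finite)
  then obtain b where b: "\<And>a. a \<in> (\<Union>K\<in>?\<K>. insert (c (w K)) (set (w K))) \<Longrightarrow> a < b"
    by (rule countable_strict_bound_omega1) (rule that)
  have "\<exists>l'\<in>\<L>. P \<zeta> K l' \<and> c l' < b \<and> (\<forall>\<alpha>\<in>set l'. \<alpha> < b)"
    if "l \<in> \<L>" "finite K \<and> K \<subseteq> {..<n} \<times> {..\<zeta>} \<and> P \<zeta> K l" for K l
  proof -
    have "w K \<in> \<L> \<and> P \<zeta> K (w K)"
      unfolding w_def using that someI[of "\<lambda>l. l \<in> \<L> \<and> P \<zeta> K l" l] by simp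
    moreover have "a < b" if "a \<in> insert (c (w K)) (set (w K))" for a
      using \<open>finite K \<and> _\<close> that by (intro b UN_I[of K]) simp_all
    ultimately show ?thesis by (intro bexI[of _ "w K"]) simp_all
  qed
  then show "\<exists>b. \<forall>K. \<forall>l\<in>\<L>. finite K \<and> K \<subseteq> {..<n} \<times> {..\<zeta>} \<and> P \<zeta> K l \<longrightarrow>
    (\<exists>l'\<in>\<L>. P \<zeta> K l' \<and> c l' < b \<and> (\<forall>\<alpha>\<in>set l'. \<alpha> < b))" by blast
qed

text \<open>At a closure point \<open>\<eta>\<close> of the reflection function where diamond
  guesses the codes of the family, a converging sequence of members exists with codes below
  \<open>\<eta>\<close>, hence in the guess. Stage \<open>\<eta>\<close> must therefore fix a
  sequence.\<close>

lemma unboundedly_many_stages: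
  assumes correct: "\<And>\<delta>. correct c A g \<delta>"
    and A: "\<And>B. stationary_omega1 {\<delta>. B \<inter> {..<\<delta>} = A \<delta>}"
    and "inj c"
    and unc: "uncountable \<F>" and disj: "pairwise disjnt \<F>"
    and card: "\<And>F. F \<in> \<F> \<Longrightarrow> finite F \<and> card F = n"
  obtains \<eta> where "\<alpha> < \<eta>" "arity (g \<eta>) = n" "\<And>i. seq (g \<eta>) i \<in> sorted_list_of_set ` \<F>"
proof -
  define \<L> where "\<L> = sorted_list_of_set ` \<F>"
  have \<L>: "length l = n \<and> distinct l" if "l \<in> \<L>" for l
    using that card by (auto simp: \<L>_def)
  have "n \<noteq> 0"
  proof
    assume "n = 0"
    then have "\<F> \<subseteq> {{}}" using card by fastforce
    then show False using unc by (meson countable_finite countable_subset finite.intros)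
  qed
  define P where "P \<zeta> K l \<longleftrightarrow> (\<forall>\<alpha>\<in>set l. \<zeta> < \<alpha>) \<and> (\<forall>(j, \<xi>)\<in>K. \<xi> \<in> bits (g (l ! j)))" for \<zeta> K l
  obtain \<psi> where \<psi>: "\<forall>\<zeta> K. \<forall>l\<in>\<L>. finite K \<and> K \<subseteq> {..<n} \<times> {..\<zeta>} \<and> P \<zeta> K l \<longrightarrow>
      (\<exists>l'\<in>\<L>. P \<zeta> K l' \<and> c l' < \<psi> \<zeta> \<and> (\<forall>\<alpha>\<in>set l'. \<alpha> < \<psi> \<zeta>))"
    using ex_reflection_function[of \<L> n P c] by (rule exE)
  obtain \<eta> where \<eta>: "\<eta> \<in> {\<delta>. c ` \<L> \<inter> {..<\<delta>} = A \<delta>}" "\<alpha> < \<eta>" "\<And>\<zeta>. \<zeta> < \<eta> \<Longrightarrow> \<psi> \<zeta> < \<eta>"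
    using stationary_omega1_closure_point[OF A] by blast
  obtain F where F: "F \<in> \<F>" "F \<inter> {..<\<eta>} = {}"
    using uncountable_disjoint_family_avoids[OF unc disj countable_lessThan_omega1] by blast
  obtain f where "converging g \<eta> n f" "\<And>i. f i \<in> \<L>" "\<And>i. c (f i) < \<eta>"
  \<comment> \<open>A member of the family above \<open>\<eta>\<close> supplies the limits: \<open>L\<^sub>j\<close> is the trace on \<open>\<eta>\<close> of the bits
      at its \<open>j\<close>-th element.\<close>
  proof (rule ex_converging[of c A g \<L> n \<eta> \<psi> "sorted_list_of_set F"])
    fix \<zeta> K l
    assume "finite K" "K \<subseteq> {..<n} \<times> {..\<zeta>}" "l \<in> \<L>" "\<forall>\<alpha>\<in>set l. \<zeta> < \<alpha>"
      "\<forall>(j, \<xi>)\<in>K. \<xi> \<in> bits (g (l ! j))"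
    then obtain l' where "l' \<in> \<L>" "P \<zeta> K l'" "c l' < \<psi> \<zeta>" "\<forall>\<alpha>\<in>set l'. \<alpha> < \<psi> \<zeta>"
      using bspec[OF spec[OF spec[OF \<psi>, of \<zeta>], of K] \<open>l \<in> \<L>\<close>] unfolding P_def by auto
    then show "\<exists>l'\<in>\<L>. (\<forall>\<alpha>\<in>set l'. \<zeta> < \<alpha> \<and> \<alpha> < \<psi> \<zeta>) \<and> c l' < \<psi> \<zeta> \<and>
        (\<forall>(j, \<xi>)\<in>K. \<xi> \<in> bits (g (l' ! j)))"
      unfolding P_def by (intro bexI[of _ l']) simp_all
  next
    show "\<eta> \<le> \<beta>" if "\<beta> \<in> set (sorted_list_of_set F)" for \<beta>
      using that F card[of F] by (auto simp: disjoint_iff not_less)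
    show "{..<\<eta>} \<noteq> {}" using \<eta>(2) by blast
    show "sorted_list_of_set F \<in> \<L>" using F(1) unfolding \<L>_def by (rule imageI)
    show "\<And>\<zeta>. \<zeta> < \<eta> \<Longrightarrow> \<psi> \<zeta> < \<eta>" by (rule \<eta>(3))
  qed ((rule correct \<L>, assumption?) | blast)+
  then have "arity (g \<eta>) \<noteq> 0"
    using \<eta>(1) by (intro correct_arity[OF correct \<open>n \<noteq> 0\<close>]) auto
  note s = correct_seq[OF correct this]
  \<comment> \<open>The fixed sequence need not be \<open>f\<close>, but its codes lie in the guess,
    so injectivity of \<open>c\<close> puts its terms in the family; their length gives the
    arity.\<close>
  have "seq (g \<eta>) i \<in> \<L>" for i
  proof -
    have "c (seq (g \<eta>) i) \<in> c ` \<L>" using s(4)[of i] \<eta>(1) by blast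
    then show ?thesis using \<open>inj c\<close> by (simp add: inj_image_mem_iff)
  qed
  then show thesis using that[OF \<eta>(2)] s(1)[of 0] \<L>[of "seq (g \<eta>) 0"] unfolding \<L>_def by simp
qed


section \<open>The space\<close>

text \<open>Value 1 from \<open>\<alpha>\<close> on puts this point into
  \<open>{x. x \<delta>}\<close> for every \<open>\<delta> \<ge> \<alpha>\<close>, in particular for
  its own index.\<close>

definition point :: "(omega1 \<Rightarrow> stage) \<Rightarrow> omega1 \<Rightarrow> omega1 \<Rightarrow> bool" where
  "point g \<alpha> \<xi> \<longleftrightarrow> \<alpha> \<le> \<xi> \<or> \<xi> \<in> bits (g \<alpha>)"

section \<open>The covering property of the points\<close>

lemma basic_open_star_fun_iff:
  assumes "finite F" "length b = card F"
  shows "x \<in> basic_open (star_fun F b) \<longleftrightarrow> (\<forall>k<card F. x (sorted_list_of_set F ! k) = b ! k)"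
proof -
  let ?l = "sorted_list_of_set F"
  have [simp]: "length ?l = card F" by simp
  have "x \<in> basic_open (star_fun F b) \<longleftrightarrow> (\<forall>\<alpha> v. map_of (zip ?l b) \<alpha> = Some v \<longrightarrow> x \<alpha> = v)"
    by (force simp: basic_open_def star_fun_def map_le_def)
  also have "\<dots> \<longleftrightarrow> (\<forall>\<alpha> v. (\<alpha>, v) \<in> set (zip ?l b) \<longrightarrow> x \<alpha> = v)"
    using assms by (simp add: map_of_eq_Some_iff)
  also have "\<dots> \<longleftrightarrow> (\<forall>k<card F. x (?l ! k) = b ! k)"
    using assms by (auto simp: set_zip)
  finally show ?thesis .
qed

lemma HFC_w_points:
  assumes correct: "\<And>\<delta>. correct c A g \<delta>"
    and A: "\<And>B. stationary_omega1 {\<delta>. B \<inter> {..<\<delta>} = A \<delta>}"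
    and "inj c"
  shows "HFC_w (range (point g))"
  unfolding HFC_w_def
proof (intro allI impI, elim conjE)
  fix n and \<F> :: "omega1 set set"
  assume unc: "uncountable \<F>" and disj: "pairwise disjnt \<F>"
    and card: "\<forall>F\<in>\<F>. finite F \<and> card F = n"
  define N where "N = {\<eta>. arity (g \<eta>) = n \<and> (\<forall>i. seq (g \<eta>) i \<in> sorted_list_of_set ` \<F>)}"
  have unb: "\<exists>\<eta>\<in>N. \<alpha> < \<eta>" for \<alpha>
    using unboundedly_many_stages[OF assms unc disj, of n \<alpha>] card unfolding N_def by blast
  have "infinite N"
  proof
    assume "finite N"
    then obtain b where "\<And>\<eta>. \<eta> \<in> N \<Longrightarrow> \<eta> < b"
      using countable_strict_bound_omega1 countable_finite by metis
    then show False using unb[of b] by (meson less_asym)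
  qed
  \<comment> \<open>Countability bounds \<open>N0\<close> and makes the subfamily countable;
    infinitude leaves, for each later point, a stage of \<open>N0\<close> outside its finite exempt
    set.\<close>
  then obtain N0 where N0: "N0 \<subseteq> N" "infinite N0" "countable N0"
    using infinite_countable_subset' by blast
  define \<F>0 where "\<F>0 = (\<Union>\<eta>\<in>N0. range (\<lambda>i. set (seq (g \<eta>) i)))"
  obtain \<beta> where \<beta>: "\<And>\<eta>. \<eta> \<in> N0 \<Longrightarrow> \<eta> < \<beta>"
    using countable_strict_bound_omega1 N0(3) by metis
  have sub: "\<F>0 \<subseteq> \<F>"
  proof
    fix F assume "F \<in> \<F>0"
    then obtain \<eta> i where "\<eta> \<in> N0" "F = set (seq (g \<eta>) i)" by (auto simp: \<F>0_def)
    moreover from this obtain F' where "F' \<in> \<F>" "seq (g \<eta>) i = sorted_list_of_set F'"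
      using N0(1) unfolding N_def by blast
    ultimately show "F \<in> \<F>" using card by simp
  qed
  have "countable (range (point g) - (\<Union>F\<in>\<F>0. basic_open (star_fun F b)))"
    if b: "length b = n" for b
  proof (rule countable_subset)
    show "countable (point g ` {..<\<beta>})" using countable_lessThan_omega1 by simp
    have "point g \<delta> \<in> (\<Union>F\<in>\<F>0. basic_open (star_fun F b))" if "\<beta> \<le> \<delta>" for \<delta>
    proof -
      have "finite (exempt (g \<delta>))" using correct by (rule correct_finite_exempt)
      then obtain \<eta> where \<eta>: "\<eta> \<in> N0" "\<eta> \<notin> exempt (g \<delta>)"
        using N0(2) by (meson finite_subset subsetI)
      have "\<eta> < \<delta>" using \<beta>[OF \<eta>(1)] that by simp
      have n: "arity (g \<eta>) = n" using \<eta> N0(1) by (auto simp: N_def)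
      have "realizes (g \<eta>) (bits (g \<delta>))"
        using \<eta> \<open>\<eta> < \<delta>\<close> by (intro correct_realizes[OF correct]) auto
      then obtain i where i: "\<And>k. k < n \<Longrightarrow> (seq (g \<eta>) i ! k \<in> bits (g \<delta>)) = b ! k"
        using b unfolding realizes_def n by blast
      obtain F where F: "F \<in> \<F>" "seq (g \<eta>) i = sorted_list_of_set F"
        using N0(1) \<eta> unfolding N_def by blast
      then have "F \<in> \<F>0" using \<eta> card unfolding \<F>0_def by (auto intro!: bexI[of _ \<eta>] image_eqI[of _ _ i])
      have "point g \<delta> (sorted_list_of_set F ! k) = b ! k" if "k < n" for k
      proof -
        have "seq (g \<eta>) i ! k \<in> set (seq (g \<eta>) i)"
          using F card that by (metis length_sorted_list_of_set nth_mem)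
        then have "seq (g \<eta>) i ! k < \<eta>"
          using correct_seq(3)[OF correct, of \<eta> i] n that by fastforce
        then have "\<not> \<delta> \<le> seq (g \<eta>) i ! k" using \<open>\<eta> < \<delta>\<close> by simp
        then show ?thesis using i[OF that] unfolding point_def F(2) by simp
      qed
      then have "point g \<delta> \<in> basic_open (star_fun F b)"
        using F b card by (subst basic_open_star_fun_iff) auto
      with \<open>F \<in> \<F>0\<close> show ?thesis by blast
    qed
    then show "range (point g) - (\<Union>F\<in>\<F>0. basic_open (star_fun F b)) \<subseteq> point g ` {..<\<beta>}"
      by (auto simp: not_less[symmetric])
  qed
  moreover have "countable \<F>0" unfolding \<F>0_def using N0(3) by auto
  ultimately show "\<exists>\<F>\<^sub>0\<subseteq>\<F>. countable \<F>\<^sub>0 \<and>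
      (\<forall>b. length b = n \<longrightarrow> countable (range (point g) - (\<Union>F\<in>\<F>\<^sub>0. basic_open (star_fun F b))))"
    using sub by blast
qed

section \<open>Failure of strong D-ness\<close>

lemma openin_two_power_coordinate: "openin two_power {x. x i}"
proof -
  have "continuous_map two_power (discrete_topology UNIV) (\<lambda>x. x i)"
    unfolding two_power_def by (rule continuous_map_product_projection) simp
  from openin_continuous_map_preimage[OF this, of "{True}"] show ?thesis
    by (simp add: two_power_def)
qed

lemma topspace_two_power: "topspace two_power = UNIV"
  by (simp add: two_power_def)

text \<open>A countable subcover has a bounded index set, which diamond can guess in full at some
  later \<open>\<delta>\<close>. As the point at \<open>\<delta>\<close> is covered, its bits meet
  the guess, and the accumulation clause contradicts local finiteness there.\<close>

lemma not_strongly_D_points: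
  assumes correct: "\<And>\<delta>. correct c A g \<delta>"
    and A: "\<And>B. stationary_omega1 {\<delta>. B \<inter> {..<\<delta>} = A \<delta>}"
    and hfc: "HFC_w (range (point g))"
  shows "\<not> strongly_D (subtopology two_power (range (point g)))"
proof
  let ?X = "range (point g)"
  let ?T = "subtopology two_power ?X"
  have top: "topspace ?T = ?X" by (simp add: topspace_two_power)
  \<comment> \<open>One index is selected per point, so that no injectivity of
    \<open>point g\<close> has to be known.\<close>
  define r where "r x = (SOME \<alpha>. point g \<alpha> = x)" for x
  have r: "point g (r x) = x" if "x \<in> ?X" for x
    using that unfolding r_def by (metis (mono_tags) rangeE someI)
  define U where "U x = {y \<in> ?X. y (r x)}" for x
  have "neighbourhood_assignment ?T U"
    unfolding neighbourhood_assignment_def top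
  proof (intro ballI conjI)
    fix x assume x: "x \<in> ?X"
    show "openin ?T (U x)"
      unfolding openin_subtopology U_def
      by (intro exI[of _ "{y. y (r x)}"] conjI openin_two_power_coordinate) auto
    have "point g (r x) (r x)" by (simp add: point_def)
    then show "x \<in> U x" using x r by (simp add: U_def)
  qed
  moreover assume "strongly_D ?T"
  then have "\<forall>U. neighbourhood_assignment ?T U \<longrightarrow> (\<exists>D\<subseteq>?X. ?X \<subseteq> (\<Union>x\<in>D. U x) \<and>
    (\<forall>z\<in>?X. \<exists>N\<subseteq>?X. finite N \<and> z \<in> ?X \<inter> (\<Inter>x\<in>N. U x) \<and> finite (D \<inter> (?X \<inter> (\<Inter>x\<in>N. U x)))))"
    unfolding strongly_D_def top .
  ultimately have "\<exists>D\<subseteq>?X. ?X \<subseteq> (\<Union>x\<in>D. U x) \<and>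
    (\<forall>z\<in>?X. \<exists>N\<subseteq>?X. finite N \<and> z \<in> ?X \<inter> (\<Inter>x\<in>N. U x) \<and> finite (D \<inter> (?X \<inter> (\<Inter>x\<in>N. U x))))"
    by iprover
  then obtain D where D: "D \<subseteq> ?X" "?X \<subseteq> (\<Union>x\<in>D. U x)"
    and fin: "\<forall>z\<in>?X. \<exists>N\<subseteq>?X. finite N \<and> z \<in> ?X \<inter> (\<Inter>x\<in>N. U x) \<and>
      finite (D \<inter> (?X \<inter> (\<Inter>x\<in>N. U x)))"
    by (elim exE conjE)
  have "inj_on r D" using r D(1) by (metis inj_onI subsetD)
  \<comment> \<open>For singletons and the pattern \<open>[True]\<close>, the covering property
    yields countably many neighbourhoods that miss only countably many points; one more
    neighbourhood is added for each of these.\<close>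
  obtain D' where D': "D' \<subseteq> D" "countable D'" "?X \<subseteq> (\<Union>x\<in>D'. U x)"
  proof (cases "countable D")
    case True
    then show thesis using that D by blast
  next
    case False
    let ?\<F> = "(\<lambda>x. {r x}) ` D"
    have "inj_on (\<lambda>x. {r x}) D" using \<open>inj_on r D\<close> by (simp add: inj_on_def)
    then have "uncountable ?\<F>" using False countable_image_inj_on by blast
    moreover have "pairwise disjnt ?\<F>" by (auto simp: pairwise_def disjnt_def)
    ultimately have "\<exists>\<F>0\<subseteq>?\<F>. countable \<F>0 \<and> (\<forall>b. length b = 1 \<longrightarrow>
        countable (?X - (\<Union>F\<in>\<F>0. basic_open (star_fun F b))))"
      using hfc unfolding HFC_w_def by simp
    then obtain \<F>0 where \<F>0: "\<F>0 \<subseteq> ?\<F>" "countable \<F>0"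
      and "countable (?X - (\<Union>F\<in>\<F>0. basic_open (star_fun F [True])))"
      by auto
    then obtain D0 where D0: "D0 \<subseteq> D" "countable D0" "\<F>0 = (\<lambda>x. {r x}) ` D0"
      using countable_subset_image by metis
    define R where "R = ?X - (\<Union>F\<in>\<F>0. basic_open (star_fun F [True]))"
    have "countable R" unfolding R_def by fact
    obtain s where s: "\<And>x. x \<in> ?X \<Longrightarrow> s x \<in> D \<and> x \<in> U (s x)"
      using D(2) by (metis UN_iff subsetD)
    show thesis
    proof (rule that)
      show "D0 \<union> s ` R \<subseteq> D" using D0 s by (auto simp: R_def)
      show "countable (D0 \<union> s ` R)" using D0 \<open>countable R\<close> by simp
      show "?X \<subseteq> (\<Union>x\<in>D0 \<union> s ` R. U x)"
      proof
        fix y assume y: "y \<in> ?X"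
        show "y \<in> (\<Union>x\<in>D0 \<union> s ` R. U x)"
        proof (cases "y \<in> R")
          case False
          then obtain x where "x \<in> D0" "y \<in> basic_open (star_fun {r x} [True])"
            using y by (auto simp: R_def D0(3))
          then have "y \<in> U x" using y by (simp add: U_def basic_open_star_fun_iff)
          with \<open>x \<in> D0\<close> show ?thesis by blast
        qed (use s y in blast)
      qed
    qed
  qed
  obtain b where b: "\<And>a. a \<in> r ` D' \<Longrightarrow> a < b"
    using countable_strict_bound_omega1[of "r ` D'"] D'(2) by auto
  obtain \<delta> where \<delta>: "\<delta> \<in> {\<delta>. r ` D' \<inter> {..<\<delta>} = A \<delta>}" "b < \<delta>"
    by (rule stationary_omega1_closure_point[OF A[of "r ` D'"], of b id])
  have less: "a < \<delta>" if "a \<in> r ` D'" for a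
    using b[OF that] \<delta>(2) by (rule less_trans)
  then have "r ` D' \<subseteq> {..<\<delta>}" by blast
  with \<delta>(1) have A\<delta>: "A \<delta> = r ` D'" by (simp add: Int_absorb2)
  have "bits (g \<delta>) \<inter> A \<delta> \<noteq> {}"
  proof -
    obtain x where "x \<in> D'" "point g \<delta> \<in> U x" using D'(3) by blast
    then have "r x \<in> bits (g \<delta>)" using less[of "r x"] by (auto simp: U_def point_def)
    then show ?thesis using A\<delta> \<open>x \<in> D'\<close> by blast
  qed
  then obtain \<gamma> j where \<gamma>: "\<gamma> \<le> \<delta>" "j < arity (g \<gamma>)" "\<And>i. seq (g \<gamma>) i ! j < \<gamma>"
    and fr: "\<exists>\<^sub>F i in sequentially. seq (g \<gamma>) i ! j \<in> A \<delta>"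
    and ev: "\<And>\<xi>. \<xi> \<in> bits (g \<delta>) \<Longrightarrow> \<xi> < \<gamma> \<Longrightarrow>
      \<forall>\<^sub>F i in sequentially. \<xi> \<in> bits (g (seq (g \<gamma>) i ! j))"
    by (rule correct_accumulation[OF correct]) (rule that)
  have "point g \<delta> \<in> ?X" by simp
  from bspec[OF fin this] obtain N where N: "finite N" "point g \<delta> \<in> ?X \<inter> (\<Inter>x\<in>N. U x)"
    and finZ: "finite (D \<inter> (?X \<inter> (\<Inter>x\<in>N. U x)))"
    by (elim exE conjE)
  \<comment> \<open>Below \<open>\<gamma>\<close> the coordinate \<open>r x\<close> is a bit of
    stage \<open>\<delta>\<close> and passes to almost all terms by the limit property; from
    \<open>\<gamma>\<close> on it exceeds the index of every term, where the value is 1 by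
    definition.\<close>
  have "\<forall>\<^sub>F i in sequentially. point g (seq (g \<gamma>) i ! j) \<in> U x" if "x \<in> N" for x
  proof (cases "r x < \<gamma>")
    case True
    then have "r x \<in> bits (g \<delta>)" using N(2) that \<gamma>(1) by (auto simp: U_def point_def)
    from ev[OF this True] show ?thesis by eventually_elim (simp add: U_def point_def)
  next
    case False
    have "seq (g \<gamma>) i ! j \<le> r x" for i using \<gamma>(3)[of i] False by simp
    then show ?thesis by (simp add: U_def point_def)
  qed
  then have "\<forall>\<^sub>F i in sequentially. \<forall>x\<in>N. point g (seq (g \<gamma>) i ! j) \<in> U x"
    using N(1) by (simp add: eventually_ball_finite)
  \<comment> \<open>The fixed sequence eventually leaves the finitely many indices in the
    neighbourhood, while infinitely many of its \<open>j\<close>-th entries are indices of members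
    of \<open>D'\<close>.\<close>
  moreover have "\<forall>\<^sub>F i in sequentially.
      set (seq (g \<gamma>) i) \<inter> r ` (D \<inter> (?X \<inter> (\<Inter>x\<in>N. U x))) = {}"
    using \<gamma>(2) finZ by (intro converging_escapes[OF correct_converging[OF correct]]) simp_all
  ultimately have "\<forall>\<^sub>F i in sequentially. (\<forall>x\<in>N. point g (seq (g \<gamma>) i ! j) \<in> U x) \<and>
      set (seq (g \<gamma>) i) \<inter> r ` (D \<inter> (?X \<inter> (\<Inter>x\<in>N. U x))) = {}"
    by eventually_elim blast
  from frequently_ex[OF frequently_eventually_conj[OF fr this]]
  obtain i where i: "\<forall>x\<in>N. point g (seq (g \<gamma>) i ! j) \<in> U x"
      "set (seq (g \<gamma>) i) \<inter> r ` (D \<inter> (?X \<inter> (\<Inter>x\<in>N. U x))) = {}" "seq (g \<gamma>) i ! j \<in> A \<delta>"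
    by (elim exE conjE)
  then obtain d where d: "d \<in> D'" "seq (g \<gamma>) i ! j = r d" using A\<delta> by blast
  moreover have "point g (r d) = d" using r d D' D by blast
  ultimately have "d \<in> D \<inter> (?X \<inter> (\<Inter>x\<in>N. U x))" using i(1) D'(1) D(1) by auto
  moreover have "seq (g \<gamma>) i ! j \<in> set (seq (g \<gamma>) i)"
    using correct_seq(1)[OF correct, of \<gamma> i] \<gamma>(2) by simp
  ultimately show False using i(2) d(2) by blast
qed

theorem mainTheorem2:
  assumes diamond
  shows "\<exists>X :: (omega1 \<Rightarrow> bool) set. HFC_w X \<and> \<not> strongly_D (subtopology two_power X)"
proof -
  obtain A where A: "\<And>B. stationary_omega1 {\<delta>. B \<inter> {..<\<delta>} = A \<delta>}"
    using assms unfolding diamond_def by blast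
  obtain c :: "omega1 list \<Rightarrow> omega1" where c: "inj c"
    using ex_inj_list_omega1 by blast
  obtain g where g: "\<And>\<delta>. correct c A g \<delta>"
    using ex_correct by blast
  have "HFC_w (range (point g))"
    using g A c by (rule HFC_w_points)
  moreover from g A this have "\<not> strongly_D (subtopology two_power (range (point g)))"
    by (rule not_strongly_D_points)
  ultimately show ?thesis by blast
qed

end
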